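(* Let $m,n\geq 3$ be integers and let $C_k$ denote the cycle on $k$ vertices. Then: (1) $\chi_{i}(C_{m}\times C_{n})=4$ if $m\equiv n\equiv 0 \pmod 4$; (2) $\chi_{i}(C_{m}\times C_{n})=5$ if either $m\neq 6$ is even and $n\geq5$ is odd, or both $m,n\geq5$ are odd, or $(m,n)=(4s+2,4t+2)$ with $s,t\geq2$, or $(m,n)=(4,4t+2)$ with $t\geq2$; (3) $\chi_{i}(C_{m}\times C_{n})=6$ if $m=4s$ for some $s\geq1$ and $n\in\{3,6\}$; (4) $\chi_{i}(C_{m}\times C_{n})=7$ if $m\in\{3,6\}$ and $n=2t+1$ with $t\geq3$; (5) $\chi_{i}(C_{m}\times C_{n})=8$ if $m\in\{3,6\}$ and $n=5$; (6) $\chi_{i}(C_{m}\times C_{n})=9$ if $m\in\{3,6\}$ and $n=3$.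
   Context: All graphs are finite and simple. An injective $k$-coloring of a graph $G$ is a function $f:V(G)\to\{1,\dots,k\}$ such that no vertex is adjacent to two distinct vertices $u,w$ with $f(u)=f(w)$. The injective chromatic number $\chi_i(G)$ is the minimum $k$ for which $G$ admits an injective $k$-coloring. The direct product $G\times H$ has vertex set $V(G)\times V(H)$, with $(g,h)(g',h')$ an edge iff $gg'\in E(G)$ and $hh'\in E(H)$. (Since $C_m\times C_n\cong C_n\times C_m$, the listed cases also determine the values for the pairs with roles of $m$ and $n$ exchanged.) *)

theory Defs
  imports "Graph_Theory.Pair_Digraph"
begin

text \<open>
  Finite simple graphs are taken in the sense of the locale \<^locale>\<open>pair_graph\<close>: an edge
  \<open>uv\<close> is represented by the two arcs \<open>(u, v)\<close> and \<open>(v, u)\<close>.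
\<close>

text \<open>
  The value of a coloring outside the vertex set is irrelevant.
\<close>

definition injective_coloring :: "'a pair_pre_digraph \<Rightarrow> nat \<Rightarrow> ('a \<Rightarrow> nat) \<Rightarrow> bool" where
  "injective_coloring G k f \<longleftrightarrow>
     f ` pverts G \<subseteq> {1..k} \<and>
     (\<forall>v \<in> pverts G. \<forall>u w. (v, u) \<in> parcs G \<and> (v, w) \<in> parcs G \<and> u \<noteq> w \<longrightarrow> f u \<noteq> f w)"

definition injective_chromatic_number :: "'a pair_pre_digraph \<Rightarrow> nat" where
  "injective_chromatic_number G = (LEAST k. \<exists>f. injective_coloring G k f)"

text \<open>The cycle on \<open>n\<close> vertices; only meaningful for \<open>n \<ge> 3\<close>.\<close>

definition cycle_graph :: "nat \<Rightarrow> nat pair_pre_digraph" where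
  "cycle_graph n =
     \<lparr> pverts = {..<n},
       parcs = {(i, j). i < n \<and> j < n \<and> (j = (i + 1) mod n \<or> i = (j + 1) mod n)} \<rparr>"

definition direct_product ::
    "'a pair_pre_digraph \<Rightarrow> 'b pair_pre_digraph \<Rightarrow> ('a \<times> 'b) pair_pre_digraph" where
  "direct_product G H =
     \<lparr> pverts = pverts G \<times> pverts H,
       parcs = {((g, h), (g', h')) | g h g' h'. (g, g') \<in> parcs G \<and> (h, h') \<in> parcs H} \<rparr>"

lemma pair_graph_cycle_graph:
  assumes "n \<ge> 3"
  shows "pair_graph (cycle_graph n)"
proof -
  have "finite (parcs (cycle_graph n))"
    by (rule finite_subset[of _ "{..<n} \<times> {..<n}"]) (auto simp: cycle_graph_def)
  moreover have "Suc i mod n \<noteq> i \<and> i \<noteq> Suc i mod n" if "i < n" for i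
    using that assms by (cases "Suc i = n") auto
  ultimately show ?thesis
    by unfold_locales (auto simp: cycle_graph_def symmetric_def intro!: symI)
qed

lemma pair_graph_direct_product:
  assumes "pair_graph G" "pair_graph H"
  shows "pair_graph (direct_product G H)"
proof -
  interpret G: pair_graph G by fact
  interpret H: pair_graph H by fact
  have "finite (parcs (direct_product G H))"
    by (rule finite_subset[of _ "(pverts G \<times> pverts H) \<times> (pverts G \<times> pverts H)"])
      (auto simp: direct_product_def dest: G.in_arcsD1 G.in_arcsD2 H.in_arcsD1 H.in_arcsD2)
  moreover have "sym (parcs (direct_product G H))"
    using G.pair_sym_arcs H.pair_sym_arcs
    by (auto simp: direct_product_def symmetric_def sym_def)
  ultimately show ?thesis
    using G.pair_finite_verts H.pair_finite_verts
    by unfold_locales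
      (auto simp: direct_product_def symmetric_def
        dest: G.in_arcsD1 G.in_arcsD2 H.in_arcsD1 H.in_arcsD2 G.pair_no_loops)
qed

text \<open>The minimum defining the injective chromatic number is attained.\<close>

lemma injective_coloring_injective_chromatic_number:
  assumes "pair_graph G"
  shows "\<exists>f. injective_coloring G (injective_chromatic_number G) f"
proof -
  interpret pair_graph G by fact
  obtain f where f: "bij_betw f (pverts G) {1..card (pverts G)}"
    using ex_bij_betw_finite_nat[OF pair_finite_verts] finite_same_card_bij[OF pair_finite_verts]
    by (metis card_atLeastAtMost diff_Suc_1 finite_atLeastAtMost)
  have "injective_coloring G (card (pverts G)) f"
    using f by (auto simp: injective_coloring_def bij_betw_def
        dest!: in_arcsD2 dest: inj_onD)
  then show ?thesis
    unfolding injective_chromatic_number_def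
    using LeastI[of "\<lambda>k. \<exists>f. injective_coloring G k f"] by blast
qed

end

theory Submission
  imports Defs
begin

text \<open>
  Two vertices of \<open>C\<^sub>m \<times> C\<^sub>n\<close> have a common neighbour iff in each coordinate they agree or differ
  by \<open>2\<close>. Stepping by \<open>2\<close> splits \<open>C\<^sub>m\<close> into closed walks of length \<open>p = m\<close> (\<open>m\<close> odd) or \<open>p = m / 2\<close>
  (\<open>m\<close> even), so the problem is to color strong products of cycles of lengths \<open>p\<close> and \<open>q\<close>.

  Upper bounds: map the two cycles homomorphically to short cycles with vertices \<open>x\<close> and \<open>y\<close> and
  use a linear form in \<open>x, y\<close>, such as \<open>x + 2 y mod 5\<close> or \<open>x + 3 y mod 7\<close>. Lower bounds: fix a
  clique \<open>A\<close> of size \<open>c\<close> in the first factor. Each column carries a set of \<open>c\<close> colors on \<open>A\<close>, and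
  consecutive columns carry disjoint sets. With only \<open>2 c\<close> colors consecutive sets are complementary,
  which is impossible when \<open>q\<close> is odd.
\<close>

section \<open>Common neighbours in a direct product of cycles\<close>

definition two_step :: "nat \<Rightarrow> nat \<Rightarrow> nat \<Rightarrow> bool" where
  "two_step m i j \<longleftrightarrow> j = (i + 2) mod m \<or> i = (j + 2) mod m"

text \<open>For \<open>m > 0\<close> this is the additive order of 2 modulo
  \<open>m\<close>.\<close>

definition half_length :: "nat \<Rightarrow> nat" where
  "half_length m = (if even m then m div 2 else m)"

lemma cycle_common_neighbour:
  assumes "(v, i) \<in> parcs (cycle_graph m)" "(v, j) \<in> parcs (cycle_graph m)"
  shows "i = j \<or> two_step m i j"
proof -
  have v: "v < m" "i < m" "j < m" and i: "i = (v + 1) mod m \<or> v = (i + 1) mod m"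
    and j: "j = (v + 1) mod m \<or> v = (j + 1) mod m"
    using assms by (auto simp: cycle_graph_def)
  have *: "(Suc ((x + 1) mod m)) mod m = (x + 2) mod m" for x
    by (simp add: mod_Suc_eq)
  have "i = j" if "v = (i + 1) mod m" "v = (j + 1) mod m"
    using that v by (auto simp: mod_if split: if_splits)
  then show ?thesis
    using i j * by (auto simp: two_step_def)
qed

lemma two_step_common_neighbour:
  assumes "i < m" "j < m" "i = j \<or> two_step m i j"
  obtains v where "v < m" "(v, i) \<in> parcs (cycle_graph m)" "(v, j) \<in> parcs (cycle_graph m)"
proof -
  have "\<exists>v<m. (v, x) \<in> parcs (cycle_graph m) \<and> (v, (x + 2) mod m) \<in> parcs (cycle_graph m)"
    if "x < m" for x
    using that by (intro exI[of _ "(x + 1) mod m"]) (auto simp: cycle_graph_def mod_Suc_eq)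
  then show ?thesis
    using assms that unfolding two_step_def by metis
qed

text \<open>Common neighbours in the product arise coordinatewise, so an injective coloring is a
  proper coloring of the strong product of the two-step graphs. Both bounds work with this
  form.\<close>

lemma injective_coloring_cycle_product_iff:
  "injective_coloring (direct_product (cycle_graph m) (cycle_graph n)) k f \<longleftrightarrow>
     f ` ({..<m} \<times> {..<n}) \<subseteq> {1..k} \<and>
     (\<forall>i<m. \<forall>i'<m. \<forall>j<n. \<forall>j'<n.
        (i = i' \<or> two_step m i i') \<and> (j = j' \<or> two_step n j j') \<and> (i, j) \<noteq> (i', j') \<longrightarrow>
        f (i, j) \<noteq> f (i', j'))" (is "?L \<longleftrightarrow> ?R")
proof
  assume L: ?L
  have "f (i, j) \<noteq> f (i', j')"
    if h: "i < m" "i' < m" "j < n" "j' < n" "i = i' \<or> two_step m i i'"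
      "j = j' \<or> two_step n j j'" "(i, j) \<noteq> (i', j')" for i i' j j'
  proof -
    obtain v where "v < m" "(v, i) \<in> parcs (cycle_graph m)" "(v, i') \<in> parcs (cycle_graph m)"
      using two_step_common_neighbour h by metis
    moreover obtain w where "w < n" "(w, j) \<in> parcs (cycle_graph n)"
        "(w, j') \<in> parcs (cycle_graph n)"
      using two_step_common_neighbour h by metis
    ultimately have "(v, w) \<in> pverts (direct_product (cycle_graph m) (cycle_graph n))"
      "((v, w), (i, j)) \<in> parcs (direct_product (cycle_graph m) (cycle_graph n))"
      "((v, w), (i', j')) \<in> parcs (direct_product (cycle_graph m) (cycle_graph n))"
      by (auto simp: direct_product_def) (auto simp: cycle_graph_def)
    then show ?thesis
      using L h(7) unfolding injective_coloring_def by blast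
  qed
  then show ?R
    using L by (auto simp: injective_coloring_def direct_product_def cycle_graph_def)
next
  assume R: ?R
  have "f u \<noteq> f w"
    if arcs: "(v, u) \<in> parcs (direct_product (cycle_graph m) (cycle_graph n))"
      "(v, w) \<in> parcs (direct_product (cycle_graph m) (cycle_graph n))" and "u \<noteq> w" for u v w
  proof -
    obtain a b i j i' j' where eqs: "v = (a, b)" "u = (i, j)" "w = (i', j')"
      by (metis surj_pair)
    have "(a, i) \<in> parcs (cycle_graph m)" "(a, i') \<in> parcs (cycle_graph m)"
      "(b, j) \<in> parcs (cycle_graph n)" "(b, j') \<in> parcs (cycle_graph n)"
      using arcs by (auto simp: direct_product_def eqs)
    then have "i = i' \<or> two_step m i i'" "j = j' \<or> two_step n j j'"
      and "i < m" "i' < m" "j < n" "j' < n"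
      by (auto dest: cycle_common_neighbour) (auto simp: cycle_graph_def)
    then show ?thesis
      using R \<open>u \<noteq> w\<close> by (auto simp: eqs)
  qed
  moreover have "pverts (direct_product (cycle_graph m) (cycle_graph n)) = {..<m} \<times> {..<n}"
    by (simp add: direct_product_def cycle_graph_def)
  moreover have "f ` ({..<m} \<times> {..<n}) \<subseteq> {1..k}"
    using R by (rule conjunct1)
  ultimately show ?L
    unfolding injective_coloring_def by metis
qed

lemma injective_chromatic_number_eqI:
  assumes "injective_coloring G k f" "\<And>k' f'. injective_coloring G k' f' \<Longrightarrow> k \<le> k'"
  shows "injective_chromatic_number G = k"
  unfolding injective_chromatic_number_def using assms by (blast intro: Least_equality)

section \<open>Upper bounds\<close>

text \<open>If \<open>p\<close> is even, the walk goes back and forth on one edge; if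
  \<open>p\<close> is odd, it goes once around the odd cycle and spends the remaining even number of
  steps on one edge.\<close>

lemma cycle_closed_walk:
  assumes "2 \<le> k" "even p \<or> (odd p \<and> odd k \<and> k \<le> p)" "0 < p"
  shows "\<exists>w. \<forall>a. w (a + p) = w a \<and> (w a, w (Suc a)) \<in> parcs (cycle_graph k)"
proof (cases "even p")
  case True
  then show ?thesis
    using assms(1)
    by (intro exI[of _ "\<lambda>a. a mod 2"]) (auto simp: cycle_graph_def mod2_eq_if)
next
  case False
  then have k: "odd k" "k \<le> p"
    using assms by auto
  \<comment> \<open>After the turn \<open>0, ..., k - 1\<close> the walk alternates on the edge
    between \<open>0\<close> and \<open>k - 1\<close>. As \<open>p - 1\<close> is even, it ends at
    \<open>k - 1\<close>, next to its start.\<close>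
  define u where "u a = (if a < k then a else if odd a then 0 else k - 1)" for a :: nat
  define w where "w a = u (a mod p)" for a
  have "(u a, u (Suc a)) \<in> parcs (cycle_graph k)" for a
    using k assms(1) by (auto simp: u_def cycle_graph_def not_less less_Suc_eq le_Suc_eq)
  moreover have "(u (p - 1), u 0) \<in> parcs (cycle_graph k)"
  proof (cases "p = k")
    case False
    then have "\<not> p - 1 < k" "even (p - 1)"
      using k \<open>odd p\<close> by auto
    then show ?thesis
      using assms(1) by (auto simp: u_def cycle_graph_def)
  qed (use assms(1) in \<open>auto simp: u_def cycle_graph_def\<close>)
  moreover have "a mod p = p - 1" if "Suc (a mod p) = p" for a
    using that by simp
  ultimately have "(w a, w (Suc a)) \<in> parcs (cycle_graph k)" for a
    unfolding w_def mod_Suc by metis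
  then show ?thesis
    by (intro exI[of _ w]) (auto simp: w_def)
qed

text \<open>Each vertex is sent to the closed walk at the position that the vertex has in its
  two-step orbit.\<close>

lemma cycle_two_step_hom:
  assumes "2 \<le> k" "0 < m"
    "even (half_length m) \<or> (odd (half_length m) \<and> odd k \<and> k \<le> half_length m)"
  obtains g where "\<And>i. i < m \<Longrightarrow> g i < k"
    "\<And>i j. i < m \<Longrightarrow> j < m \<Longrightarrow> two_step m i j \<Longrightarrow> (g i, g j) \<in> parcs (cycle_graph k)"
proof -
  define p where "p = half_length m"
  have "0 < p"
    using assms(2) by (auto simp: p_def half_length_def elim: evenE)
  with assms obtain w where per: "\<And>a. w (a + p) = w a"
    and step: "\<And>a. (w a, w (Suc a)) \<in> parcs (cycle_graph k)"
    using cycle_closed_walk[of k p] unfolding p_def by metis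
  have wmod: "w a = w (a mod p)" for a
  proof -
    have "w (b + c * p) = w b" for b c
      by (induction c) (simp_all, metis add.assoc add.commute per)
    then show ?thesis
      by (metis mod_mult_div_eq mult.commute)
  qed
  have "\<exists>g. \<forall>i<m. (g i, g ((i + 2) mod m)) \<in> parcs (cycle_graph k)"
  proof (cases "even m")
    case True
    then have m: "m = 2 * p"
      by (simp add: p_def half_length_def)
    \<comment> \<open>Within each parity class, \<open>i div 2\<close> is the position.\<close>
    have "(i + 2) mod m div 2 = Suc (i div 2) mod p" for i
      by (simp add: m mod_mult2_eq)
    then show ?thesis
      using step wmod by (intro exI[of _ "\<lambda>i. w (i div 2)"]) metis
  next
    case False
    then have p: "p = m"
      by (simp add: p_def half_length_def)
    \<comment> \<open>\<open>h\<close> is the inverse of 2 modulo \<open>m\<close>, so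
      \<open>i * h\<close> counts, modulo \<open>m\<close>, the two-steps from 0 to
      \<open>i\<close>.\<close>
    define h where "h = (m + 1) div 2"
    have h: "2 * h = m + 1"
      using False by (simp add: h_def)
    have "((i + 2) mod m * h) mod m = Suc (i * h) mod m" for i
    proof -
      have "((i + 2) mod m * h) mod m = ((i + 2) * h) mod m"
        by (simp add: mod_mult_left_eq)
      also have "(i + 2) * h = Suc (i * h) + m"
        using h by (simp add: algebra_simps)
      finally show ?thesis
        by (simp only: mod_add_self2)
    qed
    then show ?thesis
      using step wmod p by (intro exI[of _ "\<lambda>i. w (i * h)"]) metis
  qed
  then obtain g where g: "\<And>i. i < m \<Longrightarrow> (g i, g ((i + 2) mod m)) \<in> parcs (cycle_graph k)"
    by blast
  show ?thesis
  proof
    show "g i < k" if "i < m" for i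
      using g[OF that] by (simp add: cycle_graph_def)
    show "(g i, g j) \<in> parcs (cycle_graph k)" if "i < m" "j < m" "two_step m i j" for i j
      using that g[of i] g[of j] unfolding two_step_def by (auto simp: cycle_graph_def)
  qed
qed

text \<open>
  These are colorings of the strong product of the cycles of lengths \<open>k\<close> and \<open>l\<close>, where the
  degenerate cycle of length \<open>2\<close> is a single edge; \<open>k - 1\<close> stands for \<open>-1\<close> modulo \<open>k\<close>.
\<close>

definition strong_cycle_coloring :: "nat \<Rightarrow> nat \<Rightarrow> nat \<Rightarrow> (nat \<Rightarrow> nat \<Rightarrow> nat) \<Rightarrow> bool" where
  "strong_cycle_coloring k l r c \<longleftrightarrow>
     (\<forall>x\<in>{..<k}. \<forall>y\<in>{..<l}. c x y < r \<and>
        (\<forall>x'\<in>{x, (x + 1) mod k, (x + (k - 1)) mod k}. \<forall>y'\<in>{y, (y + 1) mod l, (y + (l - 1)) mod l}.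
           c x y = c x' y' \<longrightarrow> x = x' \<and> y = y'))"

text \<open>The first three strong products are complete, and all vertices get different colors. In
  the next two, a step in \<open>y\<close> moves \<open>3 * y\<close> by 3 or 4 up to sign, modulo 8
  or 7, which a difference of at most 2 in \<open>x\<close> cannot cancel. In the last, changes of 1
  and 2 up to sign never cancel modulo 5.\<close>

lemma strong_cycle_colorings:
  "strong_cycle_coloring 2 2 4 (\<lambda>x y. 2 * x + y)"
  "strong_cycle_coloring 2 3 6 (\<lambda>x y. 3 * x + y)"
  "strong_cycle_coloring 3 3 9 (\<lambda>x y. 3 * x + y)"
  "strong_cycle_coloring 3 5 8 (\<lambda>x y. (x + 3 * y) mod 8)"
  "strong_cycle_coloring 3 7 7 (\<lambda>x y. (x + 3 * y) mod 7)"
  "strong_cycle_coloring 5 5 5 (\<lambda>x y. (x + 2 * y) mod 5)"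
  by (simp_all add: strong_cycle_coloring_def lessThan_nat_numeral lessThan_Suc)

text \<open>The coloring \<open>c\<close> is pulled back along homomorphisms of the two-step graphs
  into the short cycles; \<open>Suc\<close> moves the colors from \<open>{..<r}\<close> to
  \<open>{1..r}\<close>.\<close>

lemma injective_coloring_cycle_productI:
  assumes "0 < m" "even (half_length m) \<or> (odd (half_length m) \<and> odd k \<and> k \<le> half_length m)" "2 \<le> k"
    and "0 < n" "even (half_length n) \<or> (odd (half_length n) \<and> odd l \<and> l \<le> half_length n)" "2 \<le> l"
    and c: "strong_cycle_coloring k l r c"
  shows "\<exists>f. injective_coloring (direct_product (cycle_graph m) (cycle_graph n)) r f"
proof -
  obtain g where g: "\<And>i. i < m \<Longrightarrow> g i < k"
    "\<And>i j. i < m \<Longrightarrow> j < m \<Longrightarrow> two_step m i j \<Longrightarrow> (g i, g j) \<in> parcs (cycle_graph k)"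
    using cycle_two_step_hom assms by metis
  obtain h where h: "\<And>i. i < n \<Longrightarrow> h i < l"
    "\<And>i j. i < n \<Longrightarrow> j < n \<Longrightarrow> two_step n i j \<Longrightarrow> (h i, h j) \<in> parcs (cycle_graph l)"
    using cycle_two_step_hom assms by metis
  have arc: "x \<noteq> x'" "x' \<in> {x, (x + 1) mod r, (x + (r - 1)) mod r}"
    if "(x, x') \<in> parcs (cycle_graph r)" "2 \<le> r" for x x' r
    using that by (auto simp: cycle_graph_def mod_Suc mod_if split: if_splits)
  have "c (g i) (h j) \<noteq> c (g i') (h j')"
    if "i < m" "i' < m" "j < n" "j' < n" "i = i' \<or> two_step m i i'"
      "j = j' \<or> two_step n j j'" "(i, j) \<noteq> (i', j')" for i i' j j'
  proof
    assume eq: "c (g i) (h j) = c (g i') (h j')"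
    have "g i' \<in> {g i, (g i + 1) mod k, (g i + (k - 1)) mod k}"
      using that g(2)[of i i'] arc(2)[of "g i" "g i'" k] assms by blast
    moreover have "h j' \<in> {h j, (h j + 1) mod l, (h j + (l - 1)) mod l}"
      using that h(2)[of j j'] arc(2)[of "h j" "h j'" l] assms by blast
    ultimately have "g i = g i' \<and> h j = h j'"
      using c that(1,3) g(1) h(1) eq unfolding strong_cycle_coloring_def by blast
    \<comment> \<open>Two-step pairs go to arcs, which are not loops, so equal images force equal
      vertices.\<close>
    then show False
      using that g(2)[of i i'] h(2)[of j j'] arc(1) assms by blast
  qed
  moreover have "Suc (c (g i) (h j)) \<le> r" if "i < m" "j < n" for i j
    using c g(1) h(1) that by (simp add: strong_cycle_coloring_def Suc_leI)
  ultimately have "injective_coloring (direct_product (cycle_graph m) (cycle_graph n)) r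
      (\<lambda>(i, j). Suc (c (g i) (h j)))"
    unfolding injective_coloring_cycle_product_iff by auto
  then show ?thesis
    by blast
qed

section \<open>Lower bounds\<close>

definition two_step_clique :: "nat \<Rightarrow> nat set \<Rightarrow> bool" where
  "two_step_clique m A \<longleftrightarrow> A \<subseteq> {..<m} \<and> (\<forall>i\<in>A. \<forall>j\<in>A. i = j \<or> two_step m i j)"

lemma two_step_clique_pair: "3 \<le> m \<Longrightarrow> two_step_clique m {0, 2}"
  by (auto simp: two_step_clique_def two_step_def)

lemma two_step_clique_3: "two_step_clique 3 {0, 1, 2}"
  by (auto simp: two_step_clique_def two_step_def)

lemma two_step_clique_6: "two_step_clique 6 {0, 2, 4}"
  by (auto simp: two_step_clique_def two_step_def)

text \<open>A product of cliques is a clique of the strong product.\<close>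

lemma injective_coloring_clique_bound:
  assumes "injective_coloring (direct_product (cycle_graph m) (cycle_graph n)) k f"
    and "two_step_clique m A" "two_step_clique n B"
  shows "card A * card B \<le> k"
proof -
  have "inj_on f (A \<times> B)"
    using assms unfolding injective_coloring_cycle_product_iff two_step_clique_def inj_on_def
    by (clarsimp simp: subset_iff) metis
  moreover have "f ` (A \<times> B) \<subseteq> {1..k}"
    using assms unfolding injective_coloring_cycle_product_iff two_step_clique_def by blast
  ultimately have "card (A \<times> B) \<le> card {1..k}"
    by (rule card_inj_on_le) simp
  then show ?thesis
    by (simp add: card_cartesian_product)
qed

context
  fixes m n k A f
  assumes n: "3 \<le> n" and A: "two_step_clique m A"
    and f: "injective_coloring (direct_product (cycle_graph m) (cycle_graph n)) k f"
begin

text \<open>The index counts two-steps from column 0, so that \<open>Suc\<close> always leads to the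
  next column of the orbit.\<close>

definition column_colors :: "nat \<Rightarrow> nat set" where
  "column_colors a = f ` (A \<times> {2 * a mod n})"

lemma column_colors_subset: "column_colors a \<subseteq> {1..k}"
  using f A n unfolding injective_coloring_cycle_product_iff two_step_clique_def column_colors_def
  by (auto simp: image_subset_iff)

lemma card_column_colors: "card (column_colors a) = card A"
proof -
  have "inj_on f (A \<times> {2 * a mod n})"
    using f A n unfolding injective_coloring_cycle_product_iff two_step_clique_def inj_on_def
    by (clarsimp simp: subset_iff) (metis mod_less_divisor zero_less_numeral less_le_trans)
  then show ?thesis
    by (simp add: column_colors_def card_image card_cartesian_product)
qed

lemma column_colors_disjoint: "column_colors a \<inter> column_colors (Suc a) = {}"
proof -
  have "f (i, 2 * a mod n) \<noteq> f (i', 2 * Suc a mod n)" if "i \<in> A" "i' \<in> A" for i i'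
  proof -
    define j where "j = 2 * a mod n"
    have j: "j < n" "2 * Suc a mod n = (j + 2) mod n"
      using n by (auto simp: j_def mod_simps)
    moreover have "(j + 2) mod n < n" "j \<noteq> (j + 2) mod n"
      using j n by (auto simp: mod_if)
    ultimately show ?thesis
      using f A that unfolding injective_coloring_cycle_product_iff two_step_clique_def j_def[symmetric]
      by (simp add: subset_iff two_step_def)
  qed
  then show ?thesis
    by (auto simp: column_colors_def)
qed

lemma column_colors_periodic: "column_colors (half_length n) = column_colors 0"
  by (simp add: column_colors_def half_length_def)

lemma finite_column_colors: "finite (column_colors a)"
  using column_colors_subset finite_subset by blast

lemma injective_coloring_odd_bound:
  assumes "odd (half_length n)" "A \<noteq> {}"
  shows "2 * card A < k"
proof (rule ccontr)
  assume k: "\<not> 2 * card A < k"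
  \<comment> \<open>At most \<open>card A\<close> of the \<open>k\<close> colors lie outside a
    column, and the next column needs that many.\<close>
  have compl: "column_colors (Suc a) = {1..k} - column_colors a" for a
  proof (rule card_subset_eq)
    show "column_colors (Suc a) \<subseteq> {1..k} - column_colors a"
      using column_colors_subset column_colors_disjoint by blast
    then have "card (column_colors (Suc a)) \<le> card ({1..k} - column_colors a)"
      by (intro card_mono) auto
    moreover have "card ({1..k} - column_colors a) = k - card A"
      using card_Diff_subset[OF finite_column_colors column_colors_subset]
      by (simp add: card_column_colors)
    ultimately show "card (column_colors (Suc a)) = card ({1..k} - column_colors a)"
      using k by (simp add: card_column_colors)
  qed auto
  have "column_colors a = (if even a then column_colors 0 else {1..k} - column_colors 0)" for a
    using column_colors_subset[of 0] by (induction a) (auto simp: compl)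
  \<comment> \<open>An odd number of complementations returns to column 0.\<close>
  then have "column_colors 0 = {1..k} - column_colors 0"
    using assms(1) column_colors_periodic by metis
  then have "column_colors 0 = {}"
    using column_colors_subset[of 0] by blast
  then show False
    using assms(2) by (simp add: column_colors_def)
qed

text \<open>No three of five cyclically arranged columns are pairwise non-consecutive, so each color
  occurs in at most two of them.\<close>

lemma injective_coloring_5_bound:
  assumes "n = 5"
  shows "5 * card A \<le> 2 * k"
proof -
  let ?T = column_colors
  have periodic: "?T 5 = ?T 0"
    using column_colors_periodic by (simp add: assms half_length_def)
  have disj: "?T 0 \<inter> ?T 1 = {}" "?T 1 \<inter> ?T 2 = {}" "?T 2 \<inter> ?T 3 = {}" "?T 3 \<inter> ?T 4 = {}"
    "?T 4 \<inter> ?T 0 = {}"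
    using column_colors_disjoint[of 0] column_colors_disjoint[of 1] column_colors_disjoint[of 2]
      column_colors_disjoint[of 3] column_colors_disjoint[of 4]
    by (simp_all only: periodic[symmetric] One_nat_def[symmetric] Suc_1 Suc_numeral Num.add_num_simps)
  have le: "card S \<le> k" if "S \<subseteq> {1..k}" for S
    using card_mono[OF _ that] by simp
  \<comment> \<open>Columns 1 and 4 may share colors. The two sets are chosen so that their sizes
    add up to exactly \<open>5 * card A\<close>, by inclusion-exclusion for these columns.\<close>
  have "card (?T 0 \<union> (?T 1 \<union> ?T 4)) \<le> k" "card ((?T 2 \<union> ?T 3) \<union> (?T 1 \<inter> ?T 4)) \<le> k"
    using column_colors_subset by (blast intro: le)+
  moreover have "card (?T 0 \<union> (?T 1 \<union> ?T 4)) = card A + card (?T 1 \<union> ?T 4)"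
    using disj by (subst card_Un_disjoint) (auto simp: finite_column_colors card_column_colors)
  moreover have "card ((?T 2 \<union> ?T 3) \<union> (?T 1 \<inter> ?T 4)) = 2 * card A + card (?T 1 \<inter> ?T 4)"
  proof -
    have "card (?T 2 \<union> ?T 3) = 2 * card A"
      using disj by (subst card_Un_disjoint) (auto simp: finite_column_colors card_column_colors)
    then show ?thesis
      using disj by (subst card_Un_disjoint) (auto simp: finite_column_colors)
  qed
  moreover have "card (?T 1 \<union> ?T 4) + card (?T 1 \<inter> ?T 4) = 2 * card A"
    using card_Un_Int[OF finite_column_colors finite_column_colors, of 1 4]
    by (simp add: card_column_colors)
  ultimately show ?thesis
    by linarith
qed

end

section \<open>Combining the bounds in the six cases\<close>

lemma half_length_4_mult [simp]: "half_length (4 * s) = 2 * s"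
  by (auto simp: half_length_def)

theorem theorem2p6:
  fixes m n :: nat
  assumes "m \<ge> 3" and "n \<ge> 3"
  shows "(m mod 4 = 0 \<and> n mod 4 = 0 \<longrightarrow>
           injective_chromatic_number (direct_product (cycle_graph m) (cycle_graph n)) = 4) \<and>
         ((m \<noteq> 6 \<and> even m \<and> n \<ge> 5 \<and> odd n) \<or>
          (m \<ge> 5 \<and> odd m \<and> n \<ge> 5 \<and> odd n) \<or>
          (\<exists>s t. s \<ge> 2 \<and> t \<ge> 2 \<and> m = 4 * s + 2 \<and> n = 4 * t + 2) \<or>
          (m = 4 \<and> (\<exists>t\<ge>2. n = 4 * t + 2)) \<longrightarrow>
           injective_chromatic_number (direct_product (cycle_graph m) (cycle_graph n)) = 5) \<and>
         ((\<exists>s\<ge>1. m = 4 * s) \<and> n \<in> {3, 6} \<longrightarrow>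
           injective_chromatic_number (direct_product (cycle_graph m) (cycle_graph n)) = 6) \<and>
         (m \<in> {3, 6} \<and> (\<exists>t\<ge>3. n = 2 * t + 1) \<longrightarrow>
           injective_chromatic_number (direct_product (cycle_graph m) (cycle_graph n)) = 7) \<and>
         (m \<in> {3, 6} \<and> n = 5 \<longrightarrow>
           injective_chromatic_number (direct_product (cycle_graph m) (cycle_graph n)) = 8) \<and>
         (m \<in> {3, 6} \<and> n = 3 \<longrightarrow>
           injective_chromatic_number (direct_product (cycle_graph m) (cycle_graph n)) = 9)"
proof (intro conjI impI)
  let ?G = "direct_product (cycle_graph m) (cycle_graph n)"
  have triple: "\<exists>A. two_step_clique l A \<and> card A = 3" if "l \<in> {3, 6}" for l
  proof -
    have "card {0, 1, 2 :: nat} = 3" "card {0, 2, 4 :: nat} = 3"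
      by simp_all
    then show ?thesis
      using that two_step_clique_3 two_step_clique_6 by blast
  qed
  have half_triple: "half_length l = 3" if "l \<in> {3, 6}" for l
    using that by (auto simp: half_length_def)
  have odd_bound: "2 * card A < k"
    if "injective_coloring ?G k f" "two_step_clique m A" "card A > 0" "odd (half_length n)" for A k f
    using injective_coloring_odd_bound[OF assms(2) that(2,1)] that by (auto simp: card_gt_0_iff)
  {
    assume "m mod 4 = 0 \<and> n mod 4 = 0"
    then have even: "even (half_length m)" "even (half_length n)"
      by (auto simp: mod_eq_0_iff_dvd elim!: dvdE)
    have "\<exists>f. injective_coloring ?G 4 f"
      by (rule injective_coloring_cycle_productI[OF _ _ _ _ _ _ strong_cycle_colorings(1)])
        (use assms even in auto)
    moreover have "4 \<le> k" if "injective_coloring ?G k f" for k f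
      using injective_coloring_clique_bound[OF that two_step_clique_pair two_step_clique_pair] assms
      by simp
    ultimately show "injective_chromatic_number ?G = 4"
      by (blast intro: injective_chromatic_number_eqI)
  next
    assume cases: "(m \<noteq> 6 \<and> even m \<and> n \<ge> 5 \<and> odd n) \<or>
          (m \<ge> 5 \<and> odd m \<and> n \<ge> 5 \<and> odd n) \<or>
          (\<exists>s t. s \<ge> 2 \<and> t \<ge> 2 \<and> m = 4 * s + 2 \<and> n = 4 * t + 2) \<or>
          (m = 4 \<and> (\<exists>t\<ge>2. n = 4 * t + 2))"
    have n: "odd (half_length n)" "5 \<le> half_length n"
      using cases by (auto simp: half_length_def)
    have "m \<noteq> 6" "m \<noteq> 3"
      using cases by auto
    \<comment> \<open>Among lengths at least 3, only 3 and 6 have an odd half length below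
      5.\<close>
    then have m: "even (half_length m) \<or> 5 \<le> half_length m"
      using assms(1) unfolding half_length_def by presburger
    have "\<exists>f. injective_coloring ?G 5 f"
      by (rule injective_coloring_cycle_productI[OF _ _ _ _ _ _ strong_cycle_colorings(6)])
        (use assms m n in auto)
    moreover have "5 \<le> k" if "injective_coloring ?G k f" for k f
      using odd_bound[OF that two_step_clique_pair] assms n by auto
    ultimately show "injective_chromatic_number ?G = 5"
      by (blast intro: injective_chromatic_number_eqI)
  next
    assume h: "(\<exists>s\<ge>1. m = 4 * s) \<and> n \<in> {3, 6}"
    then have m: "even (half_length m)"
      by auto
    have "\<exists>f. injective_coloring ?G 6 f"
      by (rule injective_coloring_cycle_productI[OF _ _ _ _ _ _ strong_cycle_colorings(2)])
        (use assms m half_triple[of n] h in auto)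
    moreover obtain B where B: "two_step_clique n B" "card B = 3"
      using triple h by blast
    moreover have "6 \<le> k" if "injective_coloring ?G k f" for k f
      using injective_coloring_clique_bound[OF that two_step_clique_pair B(1)] assms(1) B(2) by simp
    ultimately show "injective_chromatic_number ?G = 6"
      by (blast intro: injective_chromatic_number_eqI)
  next
    assume h: "m \<in> {3, 6} \<and> (\<exists>t\<ge>3. n = 2 * t + 1)"
    then have n: "odd (half_length n)" "7 \<le> half_length n"
      by (auto simp: half_length_def)
    have "\<exists>f. injective_coloring ?G 7 f"
      by (rule injective_coloring_cycle_productI[OF _ _ _ _ _ _ strong_cycle_colorings(5)])
        (use assms n half_triple[of m] h in auto)
    moreover obtain A where A: "two_step_clique m A" "card A = 3"
      using triple h by blast
    moreover have "7 \<le> k" if "injective_coloring ?G k f" for k f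
      using odd_bound[OF that A(1)] A(2) n(1) by simp
    ultimately show "injective_chromatic_number ?G = 7"
      by (blast intro: injective_chromatic_number_eqI)
  next
    assume h: "m \<in> {3, 6} \<and> n = 5"
    have "\<exists>f. injective_coloring ?G 8 f"
      by (rule injective_coloring_cycle_productI[OF _ _ _ _ _ _ strong_cycle_colorings(4)])
        (use assms half_triple[of m] h in \<open>auto simp: half_length_def\<close>)
    moreover obtain A where A: "two_step_clique m A" "card A = 3"
      using triple h by blast
    \<comment> \<open>Here \<open>15 \<le> 2 * k\<close>, which rounds up to 8.\<close>
    moreover have "8 \<le> k" if "injective_coloring ?G k f" for k f
      using injective_coloring_5_bound[OF assms(2) A(1) that] A(2) h by auto
    ultimately show "injective_chromatic_number ?G = 8"
      by (blast intro: injective_chromatic_number_eqI)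
  next
    assume h: "m \<in> {3, 6} \<and> n = 3"
    have "\<exists>f. injective_coloring ?G 9 f"
      by (rule injective_coloring_cycle_productI[OF _ _ _ _ _ _ strong_cycle_colorings(3)])
        (use assms half_triple[of m] h in \<open>auto simp: half_length_def\<close>)
    moreover obtain A B where AB: "two_step_clique m A" "card A = 3" "two_step_clique n B" "card B = 3"
      using triple[of m] triple[of n] h by blast
    moreover have "9 \<le> k" if "injective_coloring ?G k f" for k f
      using injective_coloring_clique_bound[OF that AB(1,3)] AB(2,4) by simp
    ultimately show "injective_chromatic_number ?G = 9"
      by (blast intro: injective_chromatic_number_eqI)
  }
qed

end
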